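(* Suppose that $U$ is a subset of $F^1_{USCB}(X)$. Then the following are equivalent: (i) $U$ is compact in $(F^1_{USCB}(X), H_{\rm send})$; (ii) $U$ is closed in $(F^1_{USCB}(X), H_{\rm send})$, $U(0)$ is relatively compact in $X$ and $U$ is equi-right-continuous at $0$; (iii) $U$ is closed in $(F^1_{USCB}(X), H_{\rm send})$, $U(0)$ is compact in $X$ and $U$ is equi-right-continuous at $0$.
   Context: $(X,d)$ is a nonempty metric space. $X\times[0,1]$ carries the metric $\overline d((x,\alpha),(y,\beta))=d(x,y)+|\alpha-\beta|$. A fuzzy set in $X$ is a function $u:X\to[0,1]$. Its $\alpha$-cuts are $[u]_\alpha=\{x\in X: u(x)\ge\alpha\}$ for $\alpha\in(0,1]$ and $[u]_0=\overline{\{x\in X:u(x)>0\}}$ (closure in $X$). $C(Y)$ and $K(Y)$ denote the sets of nonempty closed, respectively nonempty compact, subsets of a metric space $Y$. $F^1_{USC}(X)$ is the set of fuzzy sets $u$ in $X$ with $[u]_\alpha\in C(X)$ for all $\alpha\in[0,1]$; $F^1_{USCB}(X)$ is the set of $u\in F^1_{USC}(X)$ with $[u]_0\in K(X)$. For nonempty closed sets $A,B$, $H^*(A,B)=\sup_{a\in A}\inf_{b\in B}\rho(a,b)$ and $H(A,B)=\max\{H^*(A,B),H^*(B,A)\}$ is the Hausdorff distance, where $\rho$ is the underlying metric ($d$ on $X$, $\overline d$ on $X\times[0,1]$). The sendograph is ${\rm send}\,u=\{(x,t)\in X\times[0,1]:u(x)\ge t\}\cap([u]_0\times[0,1])$,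 and $H_{\rm send}(u,v)=H({\rm send}\,u,{\rm send}\,v)$ (computed with $\overline d$), which is a metric on $F^1_{USCB}(X)$. For a set $U$ of fuzzy sets, $U(0)=\bigcup_{u\in U}[u]_0$. A set $U\subseteq F^1_{USC}(X)$ is equi-right-continuous at $0$ if for each $\varepsilon>0$ there is a $\delta\in(0,1]$ such that $H([u]_\delta,[u]_0)<\varepsilon$ for all $u\in U$. A subset of a metric space is relatively compact if its closure in that space is compact. *)

theory Defs
  imports "HOL-Analysis.Analysis"
begin

text \<open>
  The metric space \<open>X\<close> is a type of class \<^class>\<open>metric_space\<close>; fuzzy sets
  are real-valued functions with values in the unit interval. The space \<open>X \<times> [0,1]\<close> is regarded
  as a subset of \<^typ>\<open>'a \<times> real\<close>.
\<close>

type_synonym 'a fuzzy = "'a \<Rightarrow> real"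

definition fuzzy_set :: "'a fuzzy \<Rightarrow> bool" where
  "fuzzy_set u \<longleftrightarrow> (\<forall>x. u x \<in> {0..1})"

definition alpha_cut :: "'a::metric_space fuzzy \<Rightarrow> real \<Rightarrow> 'a set" where
  "alpha_cut u \<alpha> = (if \<alpha> = 0 then closure {x. u x > 0} else {x. u x \<ge> \<alpha>})"

definition F1_USC :: "'a::metric_space fuzzy set" where
  "F1_USC = {u. fuzzy_set u \<and> (\<forall>\<alpha>\<in>{0..1}. closed (alpha_cut u \<alpha>) \<and> alpha_cut u \<alpha> \<noteq> {})}"

definition F1_USCB :: "'a::metric_space fuzzy set" where
  "F1_USCB = {u \<in> F1_USC. compact (alpha_cut u 0) \<and> alpha_cut u 0 \<noteq> {}}"

text \<open>
  The Hausdorff distance of unbounded closed sets may be infinite, so it takes values in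
  \<^typ>\<open>ennreal\<close>. The underlying metric is a parameter because \<open>X \<times> [0,1]\<close> carries the sum metric,
  not the Euclidean product metric of the type class instance.
\<close>

definition Hausdorff_semi :: "('b \<Rightarrow> 'b \<Rightarrow> real) \<Rightarrow> 'b set \<Rightarrow> 'b set \<Rightarrow> ennreal" where
  "Hausdorff_semi \<rho> A B = (SUP a\<in>A. INF b\<in>B. ennreal (\<rho> a b))"

definition Hausdorff :: "('b \<Rightarrow> 'b \<Rightarrow> real) \<Rightarrow> 'b set \<Rightarrow> 'b set \<Rightarrow> ennreal" where
  "Hausdorff \<rho> A B = max (Hausdorff_semi \<rho> A B) (Hausdorff_semi \<rho> B A)"

definition sum_dist :: "'a::metric_space \<times> real \<Rightarrow> 'a \<times> real \<Rightarrow> real" where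
  "sum_dist p q = dist (fst p) (fst q) + \<bar>snd p - snd q\<bar>"

definition send :: "'a::metric_space fuzzy \<Rightarrow> ('a \<times> real) set" where
  "send u = {(x, t). t \<in> {0..1} \<and> u x \<ge> t} \<inter> (alpha_cut u 0 \<times> {0..1})"

text \<open>
  On \<^const>\<open>F1_USCB\<close> the distance is finite, so the conversion to \<^typ>\<open>real\<close> loses nothing there
  (see \<open>Hausdorff_send_finite\<close>).
\<close>

definition H_send :: "'a::metric_space fuzzy \<Rightarrow> 'a fuzzy \<Rightarrow> real" where
  "H_send u v = enn2real (Hausdorff sum_dist (send u) (send v))"

definition support_union :: "'a::metric_space fuzzy set \<Rightarrow> 'a set" where
  "support_union U = (\<Union>u\<in>U. alpha_cut u 0)"

definition equi_right_continuous_at_0 :: "'a::metric_space fuzzy set \<Rightarrow> bool" where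
  "equi_right_continuous_at_0 U \<longleftrightarrow>
     (\<forall>\<epsilon>>0. \<exists>\<delta>\<in>{0<..1}. \<forall>u\<in>U. Hausdorff dist (alpha_cut u \<delta>) (alpha_cut u 0) < ennreal \<epsilon>)"

definition relatively_compact :: "'a::metric_space set \<Rightarrow> bool" where
  "relatively_compact S \<longleftrightarrow> compact (closure S)"

text \<open>Topology induced by \<^const>\<open>H_send\<close>, which is a metric by \<open>Metric_space_H_send\<close> below.\<close>

definition send_topology :: "'a::metric_space fuzzy topology" where
  "send_topology = Metric_space.mtopology F1_USCB H_send"

lemma INF_ennreal_const_add':
  fixes f :: "'b \<Rightarrow> ennreal"
  assumes "I \<noteq> {}"
  shows "(INF i\<in>I. c + f i) = c + (INF i\<in>I. f i)"
  using continuous_at_Inf_mono[of "\<lambda>x. c + x" "f ` I"]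
    continuous_add[of "at_right (Inf (f ` I))" "\<lambda>x. c" "\<lambda>x. x"] assms
  by (auto simp: mono_def image_comp add_left_mono)

lemma Hausdorff_semi_triangle:
  assumes tri: "\<And>x y z. \<rho> x z \<le> \<rho> x y + \<rho> y z" and nn: "\<And>x y. 0 \<le> \<rho> x y" and ne: "B \<noteq> {}"
  shows "Hausdorff_semi \<rho> A C \<le> Hausdorff_semi \<rho> A B + Hausdorff_semi \<rho> B C"
  unfolding Hausdorff_semi_def[of _ A C]
proof (rule SUP_least)
  fix a assume a: "a \<in> A"
  let ?K = "Hausdorff_semi \<rho> B C"
  have "(INF c\<in>C. ennreal (\<rho> a c)) \<le> ennreal (\<rho> a b) + ?K" if b: "b \<in> B" for b
  proof -
    have "(INF c\<in>C. ennreal (\<rho> a c)) \<le> (INF c\<in>C. ennreal (\<rho> a b) + ennreal (\<rho> b c))"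
      by (rule INF_mono) (metis ennreal_leI ennreal_plus nn tri)
    also have "\<dots> \<le> ennreal (\<rho> a b) + (INF c\<in>C. ennreal (\<rho> b c))"
      by (cases "C = {}") (auto simp: INF_ennreal_const_add')
    also have "\<dots> \<le> ennreal (\<rho> a b) + ?K"
      unfolding Hausdorff_semi_def by (intro add_left_mono SUP_upper b)
    finally show ?thesis .
  qed
  then have "(INF c\<in>C. ennreal (\<rho> a c)) \<le> (INF b\<in>B. ?K + ennreal (\<rho> a b))"
    by (intro INF_greatest) (simp add: add.commute)
  also have "\<dots> = ?K + (INF b\<in>B. ennreal (\<rho> a b))"
    using ne by (simp add: INF_ennreal_const_add')
  also have "\<dots> \<le> ?K + Hausdorff_semi \<rho> A B"
    unfolding Hausdorff_semi_def[of _ A B] by (intro add_left_mono SUP_upper a)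
  finally show "(INF c\<in>C. ennreal (\<rho> a c)) \<le> Hausdorff_semi \<rho> A B + ?K"
    by (simp add: add.commute)
qed

lemma Hausdorff_triangle:
  assumes "\<And>x y z. \<rho> x z \<le> \<rho> x y + \<rho> y z" "\<And>x y. 0 \<le> \<rho> x y" "B \<noteq> {}"
  shows "Hausdorff \<rho> A C \<le> Hausdorff \<rho> A B + Hausdorff \<rho> B C"
proof -
  have "Hausdorff_semi \<rho> A C \<le> Hausdorff_semi \<rho> A B + Hausdorff_semi \<rho> B C"
    and "Hausdorff_semi \<rho> C A \<le> Hausdorff_semi \<rho> C B + Hausdorff_semi \<rho> B A"
    by (rule Hausdorff_semi_triangle[OF assms])+
  moreover have "Hausdorff_semi \<rho> A B + Hausdorff_semi \<rho> B C \<le> Hausdorff \<rho> A B + Hausdorff \<rho> B C"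
    and "Hausdorff_semi \<rho> C B + Hausdorff_semi \<rho> B A \<le> Hausdorff \<rho> B C + Hausdorff \<rho> A B"
    unfolding Hausdorff_def by (intro add_mono max.cobounded1 max.cobounded2)+
  ultimately show ?thesis
    unfolding Hausdorff_def[of _ A C]
    by (intro max.boundedI) (auto simp only: add.commute[of "Hausdorff \<rho> B C"] elim: order_trans)
qed

lemma sum_dist_triangle: "sum_dist x z \<le> sum_dist x y + sum_dist y z"
  unfolding sum_dist_def using dist_triangle[of "fst x" "fst z" "fst y"] by linarith

lemma sum_dist_nonneg: "0 \<le> sum_dist x y"
  by (simp add: sum_dist_def)

lemma send_nonempty:
  assumes "u \<in> F1_USCB"
  shows "send u \<noteq> {}"
proof -
  obtain x where "x \<in> alpha_cut u 0" using assms unfolding F1_USCB_def by blast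
  then have "(x, 0) \<in> send u"
    using assms by (auto simp: send_def F1_USCB_def F1_USC_def fuzzy_set_def)
  then show ?thesis by blast
qed

lemma Hausdorff_send_finite:
  assumes u: "u \<in> F1_USCB" and v: "v \<in> F1_USCB"
  shows "Hausdorff sum_dist (send u) (send v) < top"
proof -
  have semi: "Hausdorff_semi sum_dist (send u) (send v) < top"
    if u: "u \<in> F1_USCB" and v: "v \<in> F1_USCB" for u v :: "'a fuzzy"
  proof -
    have "bounded (alpha_cut u 0 \<union> alpha_cut v 0)"
      using u v by (auto simp: F1_USCB_def compact_imp_bounded)
    then obtain r where r: "\<And>x y. x \<in> alpha_cut u 0 \<Longrightarrow> y \<in> alpha_cut v 0 \<Longrightarrow> dist x y \<le> r"
      by (metis UnI1 UnI2 bounded_two_points)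
    obtain q where q: "q \<in> send v" using send_nonempty[OF v] by blast
    have "Hausdorff_semi sum_dist (send u) (send v) \<le> ennreal (r + 1)"
      unfolding Hausdorff_semi_def
    proof (rule SUP_least)
      fix p assume p: "p \<in> send u"
      have "sum_dist p q \<le> r + 1"
        using p q r[of "fst p" "fst q"] by (auto simp: send_def sum_dist_def)
      then show "(INF b\<in>send v. ennreal (sum_dist p b)) \<le> ennreal (r + 1)"
        by (intro INF_lower2[OF q] ennreal_leI)
    qed
    then show ?thesis using ennreal_less_top le_less_trans by blast
  qed
  show ?thesis using semi[OF u v] semi[OF v u] by (simp add: Hausdorff_def)
qed

lemma Hausdorff_semi_send_zero:
  assumes u: "u \<in> F1_USCB" and v: "v \<in> F1_USCB"
    and z: "Hausdorff_semi sum_dist (send u) (send v) = 0"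
  shows "u x \<le> v x"
proof (rule ccontr)
  assume "\<not> u x \<le> v x"
  moreover have rng: "0 \<le> u x" "u x \<le> 1" "0 \<le> v x"
    using u v by (auto simp: F1_USCB_def F1_USC_def fuzzy_set_def)
  ultimately obtain a where a: "v x < a" "a < u x" "0 < a" "a < 1"
    using dense[of "v x" "u x"] by force
  have "x \<in> closure {x. u x > 0}"
    using a closure_subset by fastforce
  then have p: "(x, u x) \<in> send u"
    using rng a by (auto simp: send_def alpha_cut_def)
  have "(INF q\<in>send v. ennreal (sum_dist (x, u x) q)) \<le> Hausdorff_semi sum_dist (send u) (send v)"
    unfolding Hausdorff_semi_def by (rule SUP_upper[OF p])
  then have i: "(INF q\<in>send v. ennreal (sum_dist (x, u x) q)) = 0"
    using z by simp
  have "x \<in> closure (alpha_cut v a)"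
    unfolding closure_approachable
  proof (intro allI impI)
    fix e :: real assume "e > 0"
    let ?e = "min e (u x - a)"
    have "(INF q\<in>send v. ennreal (sum_dist (x, u x) q)) < ennreal ?e"
      using i \<open>e > 0\<close> a by (simp add: min_def)
    then obtain q where q: "q \<in> send v" "ennreal (sum_dist (x, u x) q) < ennreal ?e"
      by (auto simp: INF_less_iff)
    then have "sum_dist (x, u x) q < ?e"
      by (metis ennreal_less_iff sum_dist_nonneg)
    then have "dist x (fst q) < e" "u x - snd q < u x - a"
      unfolding sum_dist_def fst_conv snd_conv
      using zero_le_dist[of x "fst q"] by linarith+
    then show "\<exists>y\<in>alpha_cut v a. dist y x < e"
      using q(1) a by (intro bexI[of _ "fst q"]) (auto simp: send_def alpha_cut_def dist_commute)
  qed
  moreover have "closed (alpha_cut v a)"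
    using v a by (auto simp: F1_USCB_def F1_USC_def)
  ultimately show False using a by (simp add: alpha_cut_def)
qed

lemma Metric_space_H_send: "Metric_space (F1_USCB :: 'a::metric_space fuzzy set) H_send"
proof
  fix u v w :: "'a fuzzy"
  show "0 \<le> H_send u v" by (simp add: H_send_def)
  show "H_send u v = H_send v u"
    by (simp add: H_send_def Hausdorff_def max.commute)
  assume u: "u \<in> F1_USCB" and v: "v \<in> F1_USCB"
  show "H_send u v = 0 \<longleftrightarrow> u = v"
  proof
    assume "H_send u v = 0"
    then have "Hausdorff sum_dist (send u) (send v) = 0"
      using Hausdorff_send_finite[OF u v] by (auto simp: H_send_def enn2real_eq_0_iff)
    then have "Hausdorff_semi sum_dist (send u) (send v) = 0"
      "Hausdorff_semi sum_dist (send v) (send u) = 0"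
      unfolding Hausdorff_def
      by (metis le_zero_eq max.cobounded1, metis le_zero_eq max.cobounded2)
    then show "u = v"
      using Hausdorff_semi_send_zero u v by (metis antisym ext)
  next
    assume [simp]: "u = v"
    have "(INF q\<in>send v. ennreal (sum_dist p q)) \<le> 0" if "p \<in> send v" for p
      by (rule INF_lower2[OF that]) (simp add: sum_dist_def)
    then have "Hausdorff_semi sum_dist (send v) (send v) \<le> 0"
      unfolding Hausdorff_semi_def by (rule SUP_least)
    then show "H_send u v = 0" by (simp add: H_send_def Hausdorff_def)
  qed
  assume w: "w \<in> F1_USCB"
  have "Hausdorff sum_dist (send u) (send w)
      \<le> Hausdorff sum_dist (send u) (send v) + Hausdorff sum_dist (send v) (send w)"
    by (rule Hausdorff_triangle[OF sum_dist_triangle sum_dist_nonneg send_nonempty[OF v]])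
  then show "H_send u w \<le> H_send u v + H_send v w"
    using Hausdorff_send_finite[OF u v] Hausdorff_send_finite[OF v w] unfolding H_send_def
    by (metis enn2real_mono enn2real_plus ennreal_add_less_top)
qed

end

theory Submission
  imports Defs
begin

text \<open>
  Points are compared through sendographs. Two sendographs are within \<open>e\<close> of each other if every
  point of one has a point of the other within \<open>e\<close>; read at height \<open>0\<close> this compares the supports
  \<open>[u]\<^sub>0\<close>, and read at height \<open>\<delta>\<close> it compares the cuts \<open>[u]\<^sub>\<delta>\<close> up to a small loss of height. As
  \<open>[u]\<^sub>\<delta> \<subseteq> [u]\<^sub>0\<close>, equi-right-continuity at \<open>0\<close> says that, uniformly in \<open>u\<close>, each point of
  \<open>[u]\<^sub>0\<close> has a point of \<open>[u]\<^sub>\<delta>\<close> nearby.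

  A compact family has compact \<open>U(0)\<close>, because \<open>u \<mapsto> [u]\<^sub>0\<close> does not increase distances and its
  values are compact (\<open>compact_support_union\<close>). For a single \<open>u\<close> the points with \<open>u > 0\<close> are dense
  in the compact set \<open>[u]\<^sub>0\<close>, so finitely many of them, and therefore one cut \<open>[u]\<^sub>\<delta>\<close>, come close
  to all of it. This persists for all \<open>v\<close> near \<open>u\<close> (\<open>alpha_cut_dense_nearby\<close>), so compactness makes
  \<open>\<delta>\<close> uniform.

  Conversely, let \<open>K\<close> be the compact closure of \<open>U(0)\<close>. All sendographs lie in the compact cylinder
  \<open>K \<times> [0,1]\<close>. Recording which points of a finite net of the cylinder are close to \<open>send u\<close> leaves
  finitely many cases, hence \<open>U\<close> is totally bounded (\<open>mtotally_bounded_sendographs\<close>). A Cauchy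
  sequence of sendographs converges in Hausdorff distance to the set \<open>S\<close> of its cluster points, and
  the remaining question is whether \<open>S\<close> is a sendograph. The only danger is a point \<open>(x, 0)\<close> of \<open>S\<close>
  that is isolated from the part of \<open>S\<close> at positive height: it arises when bumps of the fuzzy sets
  have heights tending to \<open>0\<close>. Equi-right-continuity excludes precisely this
  (\<open>Cauchy_sendographs_converge\<close>). Total boundedness, convergence of Cauchy sequences and closedness
  of \<open>U\<close> give compactness.
\<close>

section \<open>Pointwise forms of the Hausdorff estimates\<close>

lemma Hausdorff_semi_lessD:
  assumes lt: "Hausdorff_semi \<rho> A B < ennreal e" and nn: "\<And>x y. 0 \<le> \<rho> x y" and a: "a \<in> A"
  shows "\<exists>b\<in>B. \<rho> a b < e"
proof -
  have "(INF b\<in>B. ennreal (\<rho> a b)) \<le> Hausdorff_semi \<rho> A B"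
    unfolding Hausdorff_semi_def by (rule SUP_upper[OF a])
  then have "(INF b\<in>B. ennreal (\<rho> a b)) < ennreal e"
    using lt by (rule le_less_trans)
  then show ?thesis
    using nn by (auto simp: INF_less_iff ennreal_less_iff)
qed

lemma Hausdorff_semi_leI:
  assumes "\<And>a. a \<in> A \<Longrightarrow> \<exists>b\<in>B. \<rho> a b \<le> e"
  shows "Hausdorff_semi \<rho> A B \<le> ennreal e"
  unfolding Hausdorff_semi_def
  using assms by (intro SUP_least) (meson INF_lower2 ennreal_leI)

lemma H_send_lessD:
  assumes u: "u \<in> F1_USCB" and v: "v \<in> F1_USCB" and lt: "H_send u v < e" and p: "p \<in> send u"
  shows "\<exists>q\<in>send v. sum_dist p q < e"
proof (rule Hausdorff_semi_lessD[OF _ sum_dist_nonneg p])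
  have "Hausdorff sum_dist (send u) (send v) = ennreal (H_send u v)"
    unfolding H_send_def using Hausdorff_send_finite[OF u v] by simp
  also have "\<dots> < ennreal e"
    using lt by (simp add: H_send_def ennreal_less_iff)
  finally show "Hausdorff_semi sum_dist (send u) (send v) < ennreal e"
    unfolding Hausdorff_def by simp
qed

lemma H_send_leI:
  assumes "0 \<le> e"
    and "\<And>p. p \<in> send u \<Longrightarrow> \<exists>q\<in>send v. sum_dist p q \<le> e"
    and "\<And>q. q \<in> send v \<Longrightarrow> \<exists>p\<in>send u. sum_dist q p \<le> e"
  shows "H_send u v \<le> e"
proof -
  have "Hausdorff sum_dist (send u) (send v) \<le> ennreal e"
    unfolding Hausdorff_def using assms(2,3) by (simp add: Hausdorff_semi_leI)
  then show ?thesis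
    unfolding H_send_def using assms(1) by (simp add: enn2real_leI)
qed

lemma mem_send_iff:
  assumes "u \<in> F1_USCB"
  shows "(x, t) \<in> send u \<longleftrightarrow> x \<in> alpha_cut u 0 \<and> 0 \<le> t \<and> t \<le> u x"
  using assms by (auto simp: send_def F1_USCB_def F1_USC_def fuzzy_set_def intro: order_trans)

lemma alpha_cut_subset_0: "0 < \<alpha> \<Longrightarrow> alpha_cut u \<alpha> \<subseteq> alpha_cut u 0"
  using closure_subset[of "{x. 0 < u x}"] by (auto simp: alpha_cut_def)

text \<open>
  Since positive cuts lie inside the support, one of the two semidistances vanishes, and only the
  approximation of the support by a cut remains.
\<close>

lemma equi_right_continuous_at_0_iff:
  "equi_right_continuous_at_0 U \<longleftrightarrow>
    (\<forall>\<epsilon>>0. \<exists>\<delta>\<in>{0<..1}. \<forall>u\<in>U. \<forall>x\<in>alpha_cut u 0. \<exists>y\<in>alpha_cut u \<delta>. dist x y < \<epsilon>)"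
  (is "?L \<longleftrightarrow> ?R")
proof
  assume ?L
  show ?R
  proof (intro allI impI)
    fix \<epsilon> :: real assume "0 < \<epsilon>"
    with \<open>?L\<close> obtain \<delta> where \<delta>: "\<delta> \<in> {0<..1}"
      "\<And>u. u \<in> U \<Longrightarrow> Hausdorff dist (alpha_cut u \<delta>) (alpha_cut u 0) < ennreal \<epsilon>"
      unfolding equi_right_continuous_at_0_def by blast
    have "\<exists>y\<in>alpha_cut u \<delta>. dist x y < \<epsilon>" if "u \<in> U" "x \<in> alpha_cut u 0" for u x
      using Hausdorff_semi_lessD[of dist "alpha_cut u 0" "alpha_cut u \<delta>" \<epsilon> x] \<delta>(2) that
      by (simp add: Hausdorff_def)
    with \<delta>(1) show "\<exists>\<delta>\<in>{0<..1}. \<forall>u\<in>U. \<forall>x\<in>alpha_cut u 0. \<exists>y\<in>alpha_cut u \<delta>. dist x y < \<epsilon>"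
      by blast
  qed
next
  assume ?R
  show ?L
    unfolding equi_right_continuous_at_0_def
  proof (intro allI impI)
    fix \<epsilon> :: real assume e: "0 < \<epsilon>"
    \<comment> \<open>A supremum of numbers below \<open>\<epsilon> / 2\<close> can be \<open>\<epsilon> / 2\<close>, which is still below \<open>\<epsilon>\<close>.\<close>
    with \<open>?R\<close> obtain \<delta> where \<delta>: "\<delta> \<in> {0<..1}"
      "\<And>u x. u \<in> U \<Longrightarrow> x \<in> alpha_cut u 0 \<Longrightarrow> \<exists>y\<in>alpha_cut u \<delta>. dist x y < \<epsilon> / 2"
      by (metis half_gt_zero)
    have "Hausdorff dist (alpha_cut u \<delta>) (alpha_cut u 0) < ennreal \<epsilon>" if u: "u \<in> U" for u
    proof -
      have "Hausdorff_semi dist (alpha_cut u 0) (alpha_cut u \<delta>) \<le> ennreal (\<epsilon> / 2)"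
        using \<delta>(2)[OF u] by (intro Hausdorff_semi_leI) (meson less_imp_le)
      moreover have "Hausdorff_semi dist (alpha_cut u \<delta>) (alpha_cut u 0) \<le> ennreal (\<epsilon> / 2)"
        using alpha_cut_subset_0[of \<delta> u] \<delta>(1) e
        by (intro Hausdorff_semi_leI) (auto intro!: bexI)
      moreover have "ennreal (\<epsilon> / 2) < ennreal \<epsilon>"
        using e by (simp add: ennreal_less_iff)
      ultimately show ?thesis
        unfolding Hausdorff_def by auto
    qed
    with \<delta>(1) show "\<exists>\<delta>\<in>{0<..1}. \<forall>u\<in>U.
        Hausdorff dist (alpha_cut u \<delta>) (alpha_cut u 0) < ennreal \<epsilon>"
      by blast
  qed
qed

section \<open>Compact families: union of supports and equi-right-continuity\<close>

lemma limitin_send_topology: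
  fixes \<sigma> :: "nat \<Rightarrow> 'a::metric_space fuzzy"
  shows "limitin send_topology \<sigma> u sequentially \<longleftrightarrow>
    u \<in> F1_USCB \<and> (\<forall>\<epsilon>>0. \<exists>N. \<forall>n\<ge>N. \<sigma> n \<in> F1_USCB \<and> H_send (\<sigma> n) u < \<epsilon>)"
proof -
  interpret Metric_space "F1_USCB :: 'a fuzzy set" H_send
    by (rule Metric_space_H_send)
  show ?thesis
    by (simp add: send_topology_def limit_metric_sequentially)
qed

lemma compactin_send_topology_sequentially:
  fixes U :: "'a::metric_space fuzzy set"
  shows "compactin send_topology U \<longleftrightarrow>
    U \<subseteq> F1_USCB \<and> (\<forall>\<sigma> :: nat \<Rightarrow> 'a fuzzy. range \<sigma> \<subseteq> U \<longrightarrow>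
      (\<exists>u r. u \<in> U \<and> strict_mono r \<and> limitin send_topology (\<sigma> \<circ> r) u sequentially))"
proof -
  interpret Metric_space "F1_USCB :: 'a fuzzy set" H_send
    by (rule Metric_space_H_send)
  show ?thesis
    by (simp add: send_topology_def compactin_sequentially)
qed

text \<open>
  The projection \<open>(x, t) \<mapsto> x\<close> maps \<open>send u\<close> onto \<open>[u]\<^sub>0\<close> and does not increase distances.
\<close>

lemma support_point_near:
  assumes u: "u \<in> F1_USCB" and v: "v \<in> F1_USCB" and lt: "H_send u v < e"
    and x: "x \<in> alpha_cut u 0"
  shows "\<exists>y\<in>alpha_cut v 0. dist x y < e"
proof -
  have "(x, 0) \<in> send u"
    using u x by (auto simp: mem_send_iff F1_USCB_def F1_USC_def fuzzy_set_def)
  then obtain q where "q \<in> send v" "sum_dist (x, 0) q < e"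
    using H_send_lessD[OF u v lt] by blast
  then show ?thesis
    by (intro bexI[of _ "fst q"]) (auto simp: send_def sum_dist_def)
qed

text \<open>
  Given points \<open>f n\<close> in the supports of \<open>\<sigma> n\<close>, pass to a convergent subsequence of \<open>\<sigma>\<close> with limit
  \<open>u\<close>. The points move closer and closer to the compact set \<open>[u]\<^sub>0\<close>, where their companions
  \<open>h n\<close> have a cluster point.
\<close>

lemma compact_support_union:
  fixes U :: "'a::metric_space fuzzy set"
  assumes U: "compactin send_topology U"
  shows "compact (support_union U)"
  unfolding compact_eq_seq_compact_metric
proof (rule seq_compactI)
  fix f :: "nat \<Rightarrow> 'a" assume "\<forall>n. f n \<in> support_union U"
  then have "\<forall>n. \<exists>u. u \<in> U \<and> f n \<in> alpha_cut u 0"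
    by (auto simp: support_union_def)
  then obtain \<sigma> where \<sigma>: "\<And>n. \<sigma> n \<in> U" "\<And>n. f n \<in> alpha_cut (\<sigma> n) 0"
    by metis
  then obtain u r where u: "u \<in> U" and r: "strict_mono r"
    and lim: "limitin send_topology (\<sigma> \<circ> r) u sequentially"
    using U unfolding compactin_send_topology_sequentially by (metis image_subsetI)
  have UF: "U \<subseteq> F1_USCB"
    using U by (simp add: compactin_send_topology_sequentially)
  \<comment> \<open>The positive second summand makes the distance strictly smaller than \<open>g n\<close>,
    even when the fuzzy sets agree.\<close>
  define g where "g n = H_send (\<sigma> (r n)) u + inverse (real (Suc n))" for n
  have "\<exists>y\<in>alpha_cut u 0. dist (f (r n)) y < g n" for n
    by (rule support_point_near[of "\<sigma> (r n)"]) (use \<sigma> u UF in \<open>auto simp: g_def\<close>)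
  then obtain h where h: "\<And>n. h n \<in> alpha_cut u 0" "\<And>n. dist (f (r n)) (h n) < g n"
    by metis
  have "(\<lambda>n. H_send (\<sigma> (r n)) u) \<longlonglongrightarrow> 0"
    using lim unfolding limitin_send_topology LIMSEQ_def by (fastforce simp: H_send_def)
  then have g0: "g \<longlonglongrightarrow> 0"
    unfolding g_def using tendsto_add[OF _ LIMSEQ_inverse_real_of_nat] by fastforce
  have "compact (alpha_cut u 0)"
    using u UF by (auto simp: F1_USCB_def)
  then obtain y s where y: "y \<in> alpha_cut u 0" and s: "strict_mono s" "(h \<circ> s) \<longlonglongrightarrow> y"
    using h(1) seq_compactE[OF compact_imp_seq_compact, of "alpha_cut u 0" h] by blast
  have "(\<lambda>n. dist ((h \<circ> s) n) y) \<longlonglongrightarrow> 0"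
    using s(2) by (rule tendsto_dist_iff[THEN iffD1])
  then have bound: "(\<lambda>n. (g \<circ> s) n + dist ((h \<circ> s) n) y) \<longlonglongrightarrow> 0"
    by (rule tendsto_add_zero[OF LIMSEQ_subseq_LIMSEQ[OF g0 s(1)]])
  have "dist (f (r (s n))) y \<le> g (s n) + dist (h (s n)) y" for n
    using h(2)[of "s n"] dist_triangle[of "f (r (s n))" y "h (s n)"] by linarith
  then have "(\<lambda>n. dist ((f \<circ> (r \<circ> s)) n) y) \<longlonglongrightarrow> 0"
    by (intro Lim_null_comparison[OF _ bound] always_eventually) simp
  then have "(f \<circ> (r \<circ> s)) \<longlonglongrightarrow> y"
    by (rule tendsto_dist_iff[THEN iffD2])
  moreover have "y \<in> support_union U"
    using y u by (auto simp: support_union_def)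
  moreover have "strict_mono (r \<circ> s)"
    using r s(1) by (rule strict_mono_o)
  ultimately show "\<exists>y\<in>support_union U. \<exists>r. strict_mono r \<and> (f \<circ> r) \<longlonglongrightarrow> y"
    by blast
qed

text \<open>
  The balls around the points with \<open>u > 0\<close> cover the compact support, so finitely many suffice; the
  least value of \<open>u\<close> at their centres serves as \<open>\<delta>\<close>.
\<close>

lemma alpha_cut_dense_in_support:
  assumes u: "u \<in> F1_USCB" and e: "0 < \<epsilon>"
  obtains \<delta> where "0 < \<delta>" "\<delta> \<le> 1" "\<And>x. x \<in> alpha_cut u 0 \<Longrightarrow> \<exists>y\<in>alpha_cut u \<delta>. dist x y < \<epsilon>"
proof -
  have "alpha_cut u 0 \<subseteq> (\<Union>z\<in>{x. 0 < u x}. ball z \<epsilon>)"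
    using e by (auto simp: alpha_cut_def closure_approachable)
  moreover have "compact (alpha_cut u 0)"
    using u by (simp add: F1_USCB_def)
  ultimately obtain F where F: "F \<subseteq> {x. 0 < u x}" "finite F" "alpha_cut u 0 \<subseteq> (\<Union>z\<in>F. ball z \<epsilon>)"
    using compactE_image[of "alpha_cut u 0" "{x. 0 < u x}" "\<lambda>z. ball z \<epsilon>"] by auto
  define \<delta> where "\<delta> = Min (insert 1 (u ` F))"
  have "0 < \<delta>" "\<delta> \<le> 1" "\<And>z. z \<in> F \<Longrightarrow> \<delta> \<le> u z"
    unfolding \<delta>_def using F(1,2) by auto
  then show thesis
    using F(3) by (intro that[of \<delta>]) (fastforce simp: alpha_cut_def dist_commute)+
qed

text \<open>
  Move from the support of \<open>v\<close> to that of \<open>u\<close>, from there to the cut of \<open>u\<close> at height \<open>d\<close>, and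
  lift the point reached to \<open>(z, d)\<close> before returning to \<open>send v\<close>: the return loses less than
  \<open>d / 2\<close> of height, so the final point has height above \<open>d / 2\<close>.
\<close>

lemma alpha_cut_dense_nearby:
  assumes u: "u \<in> F1_USCB" and e: "0 < \<epsilon>"
  obtains \<delta> \<eta> where "0 < \<delta>" "0 < \<eta>"
    "\<And>v x. v \<in> F1_USCB \<Longrightarrow> H_send v u < \<eta> \<Longrightarrow> x \<in> alpha_cut v 0 \<Longrightarrow>
      \<exists>y\<in>alpha_cut v \<delta>. dist x y < \<epsilon>"
proof -
  obtain d where d: "0 < d" "d \<le> 1" "\<And>x. x \<in> alpha_cut u 0 \<Longrightarrow> \<exists>y\<in>alpha_cut u d. dist x y < \<epsilon> / 3"
    using alpha_cut_dense_in_support[OF u, of "\<epsilon> / 3"] e by auto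
  define \<eta> where "\<eta> = min (d / 2) (\<epsilon> / 3)"
  have "0 < \<eta>" using d e by (simp add: \<eta>_def)
  show thesis
  proof (rule that[of "d / 2" \<eta>])
    fix v x assume v: "v \<in> F1_USCB" and lt: "H_send v u < \<eta>" and x: "x \<in> alpha_cut v 0"
    obtain y where y: "y \<in> alpha_cut u 0" "dist x y < \<eta>"
      using support_point_near[OF v u lt x] by blast
    obtain z where z: "z \<in> alpha_cut u d" "dist y z < \<epsilon> / 3"
      using d(3)[OF y(1)] by blast
    have "(z, d) \<in> send u"
      using z(1) d alpha_cut_subset_0[of d u] by (auto simp: mem_send_iff[OF u] alpha_cut_def)
    moreover have "H_send u v < \<eta>"
      using lt by (simp add: H_send_def Hausdorff_def max.commute)
    ultimately obtain w t where w: "(w, t) \<in> send v" "sum_dist (z, d) (w, t) < \<eta>"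
      using H_send_lessD[OF u v] by (metis surj_pair)
    then have "dist z w + \<bar>d - t\<bar> < d / 2" "dist z w + \<bar>d - t\<bar> < \<epsilon> / 3"
      by (simp_all add: sum_dist_def \<eta>_def)
    then have "dist z w < \<epsilon> / 3" "d / 2 < t"
      using zero_le_dist[of z w] by linarith+
    moreover have "dist x y < \<epsilon> / 3"
      using y(2) by (simp add: \<eta>_def)
    ultimately have "dist x w < \<epsilon>"
      using z(2) dist_triangle[of x w y] dist_triangle[of y w z] by linarith
    moreover have "w \<in> alpha_cut v (d / 2)"
      using w(1) \<open>d / 2 < t\<close> d(1) by (simp add: mem_send_iff[OF v] alpha_cut_def)
    ultimately show "\<exists>y\<in>alpha_cut v (d / 2). dist x y < \<epsilon>" by blast
  qed (use d \<open>0 < \<eta>\<close> in auto)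
qed

text \<open>
  If it fails, there are \<open>\<sigma> n \<in> U\<close> for which the cut at height \<open>1 / (n + 1)\<close> misses part of
  the support by \<open>\<epsilon>\<close>. Near a cluster point of \<open>\<sigma>\<close> one positive height works for all members of the
  sequence, and the larger cuts at the lower heights \<open>1 / (n + 1)\<close> then do as well.
\<close>

lemma compact_imp_equi_right_continuous:
  assumes U: "compactin send_topology U"
  shows "equi_right_continuous_at_0 U"
proof (rule ccontr)
  assume "\<not> ?thesis"
  then obtain \<epsilon> where e: "0 < \<epsilon>"
    and neg: "\<And>\<delta>. \<delta> \<in> {0<..1} \<Longrightarrow> \<exists>u\<in>U. \<exists>x\<in>alpha_cut u 0. \<not> (\<exists>y\<in>alpha_cut u \<delta>. dist x y < \<epsilon>)"
    unfolding equi_right_continuous_at_0_iff by blast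
  define \<delta> where "\<delta> n = inverse (real (Suc n))" for n
  have \<delta>: "\<delta> n \<in> {0<..1}" for n
    by (simp add: \<delta>_def inverse_le_1_iff)
  have "\<forall>n. \<exists>u\<in>U. \<exists>x\<in>alpha_cut u 0. \<not> (\<exists>y\<in>alpha_cut u (\<delta> n). dist x y < \<epsilon>)"
    using neg \<delta> by blast
  then obtain \<sigma> f where \<sigma>: "\<And>n. \<sigma> n \<in> U" "\<And>n. f n \<in> alpha_cut (\<sigma> n) 0"
    and far: "\<And>n y. y \<in> alpha_cut (\<sigma> n) (\<delta> n) \<Longrightarrow> \<not> dist (f n) y < \<epsilon>"
    by metis
  then obtain u r where u: "u \<in> U" and r: "strict_mono r"
    and lim: "limitin send_topology (\<sigma> \<circ> r) u sequentially"
    using U unfolding compactin_send_topology_sequentially by (metis image_subsetI)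
  have UF: "U \<subseteq> F1_USCB"
    using U by (simp add: compactin_send_topology_sequentially)
  obtain d \<eta> where d: "0 < d" "0 < \<eta>" and near:
    "\<And>v x. v \<in> F1_USCB \<Longrightarrow> H_send v u < \<eta> \<Longrightarrow> x \<in> alpha_cut v 0 \<Longrightarrow> \<exists>y\<in>alpha_cut v d. dist x y < \<epsilon>"
    using alpha_cut_dense_nearby[of u \<epsilon>] u UF e by blast
  obtain N where N: "\<And>n. n \<ge> N \<Longrightarrow> H_send (\<sigma> (r n)) u < \<eta>"
    using lim d(2) unfolding limitin_send_topology by (metis comp_apply)
  obtain m where m: "\<delta> m < d"
    using reals_Archimedean[OF d(1)] unfolding \<delta>_def by blast
  define n where "n = max N m"
  have "m \<le> r n"
    using seq_suble[OF r, of n] by (simp add: n_def)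
  then have "\<delta> (r n) \<le> \<delta> m"
    by (simp add: \<delta>_def)
  with m have "\<delta> (r n) < d" by simp
  then have "alpha_cut (\<sigma> (r n)) d \<subseteq> alpha_cut (\<sigma> (r n)) (\<delta> (r n))"
    using d(1) \<delta>[of "r n"] by (auto simp: alpha_cut_def)
  moreover obtain y where "y \<in> alpha_cut (\<sigma> (r n)) d" "dist (f (r n)) y < \<epsilon>"
    using near[of "\<sigma> (r n)" "f (r n)"] N[of n] \<sigma> UF by (auto simp: n_def)
  ultimately show False
    using far by blast
qed

section \<open>Total boundedness\<close>

text \<open>
  The two estimates below show that \<^const>\<open>sum_dist\<close> is equivalent to the metric of the product type,
  so that compactness and closure in \<^typ>\<open>'a \<times> real\<close> may be used for it.
\<close>

lemma sum_dist_le_dist: "sum_dist p q \<le> 2 * dist p q"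
  using dist_fst_le[of p q] dist_snd_le[of p q] by (simp add: sum_dist_def dist_real_def)

lemma dist_le_sum_dist: "dist p q \<le> sum_dist p q"
  by (auto simp: sum_dist_def dist_prod_def dist_real_def intro: sqrt_sum_squares_le_sum_abs[THEN order_trans])

lemma sum_dist_commute: "sum_dist p q = sum_dist q p"
  by (simp add: sum_dist_def dist_commute abs_minus_commute)

lemma send_subset_cylinder:
  "u \<in> U \<Longrightarrow> support_union U \<subseteq> K \<Longrightarrow> send u \<subseteq> K \<times> {0..1}"
  by (auto simp: send_def support_union_def)

text \<open>
  The trace of a fuzzy set on a finite net \<open>F\<close> of the cylinder is the set of net points close to its
  sendograph. Fuzzy sets with equal trace are close, because a point of one sendograph can be
  exchanged for a point of the other through a common net point. One representative for each of the
  finitely many traces gives the required finite set of centres.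
\<close>

lemma mtotally_bounded_sendographs:
  fixes U :: "'a::metric_space fuzzy set"
  assumes UF: "U \<subseteq> F1_USCB" and K: "compact K" "support_union U \<subseteq> K"
  shows "Metric_space.mtotally_bounded F1_USCB H_send U"
proof -
  interpret Metric_space "F1_USCB :: 'a fuzzy set" H_send
    by (rule Metric_space_H_send)
  show ?thesis
    unfolding mtotally_bounded_def
  proof (intro allI impI)
    fix \<epsilon> :: real assume e: "0 < \<epsilon>"
    have "compact (K \<times> {0..1::real})"
      using K by (simp add: compact_Times)
    then have "\<forall>\<epsilon>>0. \<exists>F. finite F \<and> K \<times> {0..1::real} \<subseteq> (\<Union>p\<in>F. ball p \<epsilon>)"
      by (rule compact_eq_totally_bounded[THEN iffD1, THEN conjunct2])
    from this[rule_format, of "\<epsilon> / 8"] e obtain F where F: "finite F" "K \<times> {0..1::real} \<subseteq> (\<Union>p\<in>F. ball p (\<epsilon> / 8))"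
      by auto
    define trace where "trace u = {p \<in> F. \<exists>q\<in>send u. sum_dist p q \<le> \<epsilon> / 4}" for u :: "'a fuzzy"
    have "finite (trace ` U)"
      using F(1) by (auto simp: trace_def intro: finite_subset[of _ "Pow F"])
    then obtain V where V: "V \<subseteq> U" "finite V" "trace ` U = trace ` V"
      using finite_subset_image[of "trace ` U" trace U] by auto
    have near: "\<exists>q\<in>send v. sum_dist p q \<le> \<epsilon> / 2"
      if u: "u \<in> U" and eq: "trace u = trace v" and p: "p \<in> send u" for u v p
    proof -
      obtain c where c: "c \<in> F" "dist c p < \<epsilon> / 8"
        using subsetD[OF F(2) subsetD[OF send_subset_cylinder[OF u K(2)] p]] by auto
      then have cp: "sum_dist c p \<le> \<epsilon> / 4"
        using sum_dist_le_dist[of c p] by simp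
      with c p have "c \<in> trace v"
        unfolding eq[symmetric] by (auto simp: trace_def)
      then obtain q where "q \<in> send v" "sum_dist c q \<le> \<epsilon> / 4"
        by (auto simp: trace_def)
      with cp show ?thesis
        using sum_dist_triangle[of p q c] sum_dist_commute[of p c] by force
    qed
    have "U \<subseteq> (\<Union>v\<in>V. mball v \<epsilon>)"
    proof
      fix u assume u: "u \<in> U"
      then obtain v where v: "v \<in> V" "trace u = trace v"
        using V(3) by (metis imageE imageI)
      have "H_send v u \<le> \<epsilon> / 2"
        using near u v V(1) e by (intro H_send_leI) (auto simp: subset_eq)
      then have "u \<in> mball v \<epsilon>"
        using u v V(1) UF e by auto
      with v(1) show "u \<in> (\<Union>v\<in>V. mball v \<epsilon>)" by blast
    qed
    with V show "\<exists>V. finite V \<and> V \<subseteq> U \<and> U \<subseteq> (\<Union>v\<in>V. mball v \<epsilon>)" by blast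
  qed
qed

section \<open>Completeness\<close>

text \<open>
  The fuzzy set is read off as the upper boundary of \<open>S\<close>: \<open>u x\<close> is the largest height of \<open>S\<close> over
  \<open>x\<close>. For \<open>t > 0\<close> the cut of \<open>u\<close> is the slice of \<open>S\<close> at height \<open>t\<close>. At height \<open>0\<close> the cut is
  instead the closure of the union of the positive slices, and the last hypothesis makes it agree
  with the slice.
\<close>

lemma sendograph_realization:
  fixes S :: "('a::metric_space \<times> real) set"
  assumes S: "compact S" and range: "\<And>x t. (x, t) \<in> S \<Longrightarrow> 0 \<le> t \<and> t \<le> 1"
    and down: "\<And>x s t. (x, t) \<in> S \<Longrightarrow> 0 \<le> s \<Longrightarrow> s \<le> t \<Longrightarrow> (x, s) \<in> S"
    and top: "\<exists>x. (x, 1) \<in> S"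
    and base: "\<And>x \<epsilon>. (x, 0) \<in> S \<Longrightarrow> 0 < \<epsilon> \<Longrightarrow> \<exists>y t. (y, t) \<in> S \<and> 0 < t \<and> dist y x < \<epsilon>"
  obtains u where "u \<in> F1_USCB" "send u = S"
proof -
  \<comment> \<open>The inserted \<open>0\<close> gives \<open>u\<close> the value \<open>0\<close> over points \<open>x\<close> where \<open>S\<close> is empty.\<close>
  define T where "T x = insert 0 {t. (x, t) \<in> S}" for x
  define u where "u x = Sup (T x)" for x
  have "closed S" using S by (rule compact_imp_closed)
  have "closed {t. (x, t) \<in> S}" for x
    using closed_vimage[OF \<open>closed S\<close>, of "\<lambda>t. (x, t)"]
    by (simp add: vimage_def continuous_on_Pair[OF continuous_on_const continuous_on_id] continuous_on_Pair[OF continuous_on_id continuous_on_const])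
  then have T: "closed (T x)" "bdd_above (T x)" "T x \<noteq> {}" for x
    unfolding T_def using range by (auto intro!: closed_insert bdd_aboveI[of _ 1])
  have mem: "u x \<in> T x" for x
    unfolding u_def using T by (intro closed_contains_Sup)
  have upper: "t \<le> u x" if "(x, t) \<in> S" for x t
    unfolding u_def using T that by (intro cSup_upper) (auto simp: T_def)
  have u01: "0 \<le> u x" "u x \<le> 1" for x
    using mem[of x] range by (auto simp: T_def)
  have pos: "t \<le> u x \<longleftrightarrow> (x, t) \<in> S" if "0 < t" for x t
    using mem[of x] upper[of x t] down[of x "u x" t] that by (auto simp: T_def)
  have cl: "closed {x. (x, t) \<in> S}" for t
    using closed_vimage[OF \<open>closed S\<close>, of "\<lambda>x. (x, t)"]
    by (simp add: vimage_def continuous_on_Pair[OF continuous_on_const continuous_on_id] continuous_on_Pair[OF continuous_on_id continuous_on_const])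
  have cut: "alpha_cut u t = {x. (x, t) \<in> S}" if t: "0 \<le> t" for t
  proof (cases "t = 0")
    case False
    with t show ?thesis by (auto simp: alpha_cut_def pos)
  next
    case True
    have "closure {x. 0 < u x} = {x. (x, 0) \<in> S}"
    proof
      show "closure {x. 0 < u x} \<subseteq> {x. (x, 0) \<in> S}"
      proof (rule closure_minimal[OF _ cl], clarify)
        fix x assume "0 < u x"
        then have "(x, u x) \<in> S" using pos[of "u x" x] by simp
        then show "(x, 0) \<in> S" using down u01 by blast
      qed
      show "{x. (x, 0) \<in> S} \<subseteq> closure {x. 0 < u x}"
      proof
        fix x assume "x \<in> {x. (x, 0) \<in> S}"
        then have x: "(x, 0) \<in> S" by simp
        show "x \<in> closure {x. 0 < u x}"
          unfolding closure_approachable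
        proof (intro allI impI)
          fix e :: real assume "0 < e"
          then obtain y t where "(y, t) \<in> S" "0 < t" "dist y x < e"
            using base[OF x] by blast
          then show "\<exists>y\<in>{x. 0 < u x}. dist y x < e"
            using upper[of y t] by (intro bexI[of _ y]) auto
        qed
      qed
    qed
    with True show ?thesis by (simp add: alpha_cut_def)
  qed
  have "(x, 0) \<in> S" if "(x, t) \<in> S" for x t
    using down[OF that] range[OF that] by simp
  then have "fst ` S = {x. (x, 0) \<in> S}"
    by force
  then have cpt: "compact {x. (x, 0) \<in> S}"
    using compact_continuous_image[OF continuous_on_fst[OF continuous_on_id] S] by simp
  have ne: "\<exists>x. (x, t) \<in> S" if "0 \<le> t" "t \<le> 1" for t
    using top down that by blast
  have u: "u \<in> F1_USCB"
    unfolding F1_USCB_def F1_USC_def fuzzy_set_def using u01 cut cl cpt ne by auto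
  moreover have "send u = S"
  proof (rule set_eqI, clarify)
    fix x t
    show "(x, t) \<in> send u \<longleftrightarrow> (x, t) \<in> S"
    proof (cases "0 < t")
      case True
      then show ?thesis
        using mem_send_iff[OF u, of x t] cut[of 0] pos[of t x] down[of x t 0] by auto
    next
      case False
      then show ?thesis
        using mem_send_iff[OF u, of x t] cut[of 0] u01[of x] range[of x t]
        by (cases "t = 0") auto
    qed
  qed
  ultimately show thesis by (rule that)
qed

text \<open>
  The sendographs converge to the set \<open>S\<close> of all their cluster points. \<open>S\<close> inherits from them that
  it is closed downwards and reaches height \<open>1\<close>. Equi-right-continuity enters once, to show
  that \<open>S\<close> has points of positive height close to any \<open>(x, 0) \<in> S\<close>: approximate \<open>(x, 0)\<close> by a point
  of some \<open>send (\<sigma> n)\<close>, move within the support of \<open>\<sigma> n\<close> to a point where \<open>\<sigma> n\<close> is at least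
  \<open>\<delta>\<close>, and go back to \<open>S\<close> from height \<open>\<delta>\<close>.
\<close>

lemma Cauchy_sendographs_converge:
  fixes \<sigma> :: "nat \<Rightarrow> 'a::metric_space fuzzy"
  assumes UF: "U \<subseteq> F1_USCB" and K: "compact K" "support_union U \<subseteq> K"
    and equi: "equi_right_continuous_at_0 U"
    and \<sigma>: "\<And>n. \<sigma> n \<in> U"
    and Cauchy: "\<And>e. 0 < e \<Longrightarrow> \<exists>N. \<forall>m\<ge>N. \<forall>n\<ge>N. H_send (\<sigma> m) (\<sigma> n) < e"
  obtains u where "limitin send_topology \<sigma> u sequentially"
proof -
  have F: "\<sigma> n \<in> F1_USCB" for n
    using UF \<sigma> by blast
  define S where "S = (\<Inter>N. closure (\<Union>n\<in>{N..}. send (\<sigma> n)))"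
  have cyl: "send (\<sigma> n) \<subseteq> K \<times> {0..1}" for n
    using send_subset_cylinder[OF \<sigma> K(2)] .
  have cK: "compact (K \<times> {0..1::real})"
    using K by (simp add: compact_Times)
  have S_cyl: "S \<subseteq> K \<times> {0..1}"
  proof -
    have "closure (\<Union>n\<in>{0..}. send (\<sigma> n)) \<subseteq> K \<times> {0..1}"
      using cyl cK by (intro closure_minimal compact_imp_closed) auto
    moreover have "S \<subseteq> closure (\<Union>n\<in>{0..}. send (\<sigma> n))"
      unfolding S_def by (rule INF_lower) simp
    ultimately show ?thesis by (rule order_trans[rotated])
  qed
  have "closed S"
    unfolding S_def by auto
  then have "compact S"
    using S_cyl cK by (metis compact_Int_closed inf.absorb_iff2)
  have S_near: "\<exists>n\<ge>N. \<exists>q\<in>send (\<sigma> n). sum_dist p q < e" if p: "p \<in> S" and e: "0 < e" for p e N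
  proof -
    have "p \<in> closure (\<Union>n\<in>{N..}. send (\<sigma> n))"
      using p by (simp add: S_def)
    then obtain n q where "N \<le> n" "q \<in> send (\<sigma> n)" "dist q p < e / 2"
      using e unfolding closure_approachable by (metis UN_E atLeast_iff half_gt_zero)
    moreover from this have "sum_dist p q < e"
      using sum_dist_le_dist[of p q] by (simp add: dist_commute)
    ultimately show ?thesis by blast
  qed
  have S_I: "p \<in> S" if p: "\<And>e N. 0 < e \<Longrightarrow> \<exists>n\<ge>N. \<exists>q\<in>send (\<sigma> n). sum_dist p q < e" for p
    unfolding S_def
  proof (intro INT_I closure_approachable[THEN iffD2] allI impI)
    fix N :: nat and e :: real assume "0 < e"
    then obtain n q where "n \<ge> N" "q \<in> send (\<sigma> n)" "sum_dist p q < e"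
      using p by blast
    then show "\<exists>q\<in>\<Union>n\<in>{N..}. send (\<sigma> n). dist q p < e"
      using dist_le_sum_dist[of p q] by (intro bexI[of _ q]) (auto simp: dist_commute)
  qed
  \<comment> \<open>The offset \<open>M\<close> allows sequences that lie in the sendographs only from \<open>M\<close> on. The indices
    \<open>r n\<close> need not be monotone; \<open>n \<le> r n\<close> is enough to pass tail estimates to the limit.\<close>
  have cluster: "\<exists>q\<in>S. \<exists>r. (\<forall>n. n \<le> r n) \<and> (\<lambda>n. f (r n)) \<longlonglongrightarrow> q"
    if f: "\<And>n. n \<ge> M \<Longrightarrow> f n \<in> send (\<sigma> n)" for f M
  proof -
    have "\<forall>n. f (n + M) \<in> K \<times> {0..1}"
      using f cyl by (meson le_add2 subsetD)
    then obtain q r where r: "strict_mono r" and q: "((\<lambda>n. f (n + M)) \<circ> r) \<longlonglongrightarrow> q"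
      using seq_compactE[OF compact_imp_seq_compact[OF cK], of "\<lambda>n. f (n + M)"] by blast
    have ge: "n \<le> r n + M" for n
      using seq_suble[OF r, of n] by simp
    have "q \<in> closure (\<Union>n\<in>{N..}. send (\<sigma> n))" for N
    proof (rule Lim_in_closed_set[OF closed_closure _ sequentially_bot q])
      show "\<forall>\<^sub>F n in sequentially. ((\<lambda>n. f (n + M)) \<circ> r) n \<in> closure (\<Union>n\<in>{N..}. send (\<sigma> n))"
        using eventually_ge_at_top[of N]
      proof eventually_elim
        case (elim n)
        have "f (r n + M) \<in> (\<Union>n\<in>{N..}. send (\<sigma> n))"
          using f[of "r n + M"] elim ge[of n] by (intro UN_I[of "r n + M"]) auto
        then show ?case
          unfolding o_def by (rule subsetD[OF closure_subset])
      qed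
    qed
    then have "q \<in> S" by (simp add: S_def)
    then show ?thesis
      using q ge by (intro bexI[of _ q] exI[of _ "\<lambda>n. r n + M"]) (simp_all add: o_def)
  qed
  \<comment> \<open>From \<open>p \<in> send (\<sigma> n)\<close>, points of all later sendographs stay within \<open>e / 2\<close>, and so does a
    cluster point of them. From \<open>p \<in> S\<close>, some late sendograph comes near \<open>p\<close>, and the Cauchy property
    transfers this to \<open>send (\<sigma> n)\<close>.\<close>
  have conv: "\<exists>N. \<forall>n\<ge>N. (\<forall>p\<in>send (\<sigma> n). \<exists>q\<in>S. sum_dist p q \<le> e) \<and>
      (\<forall>p\<in>S. \<exists>q\<in>send (\<sigma> n). sum_dist p q \<le> e)" if e: "0 < e" for e
  proof -
    obtain N where N: "\<And>m n. m \<ge> N \<Longrightarrow> n \<ge> N \<Longrightarrow> H_send (\<sigma> m) (\<sigma> n) < e / 2"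
      using Cauchy[of "e / 2"] e by auto
    have "\<exists>q\<in>S. sum_dist p q \<le> e" if n: "n \<ge> N" and p: "p \<in> send (\<sigma> n)" for n p
    proof -
      have "\<forall>m. \<exists>q. m \<ge> N \<longrightarrow> q \<in> send (\<sigma> m) \<and> sum_dist p q < e / 2"
        using H_send_lessD[OF F F N[OF n] p] by blast
      then obtain f where f: "\<And>m. m \<ge> N \<Longrightarrow> f m \<in> send (\<sigma> m)"
        "\<And>m. m \<ge> N \<Longrightarrow> sum_dist p (f m) < e / 2"
        by metis
      obtain q r where q: "q \<in> S" "\<And>k. k \<le> r k" "(\<lambda>k. f (r k)) \<longlonglongrightarrow> q"
        using cluster[of N f] f(1) by blast
      have "(\<lambda>k. sum_dist p (f (r k))) \<longlonglongrightarrow> sum_dist p q"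
        unfolding sum_dist_def by (intro tendsto_intros q(3))
      moreover have "sum_dist p (f (r k)) \<le> e" if "k \<ge> N" for k
        using f(2)[of "r k"] q(2)[of k] that e by linarith
      ultimately have "sum_dist p q \<le> e"
        by (intro LIMSEQ_le_const2) blast+
      with q(1) show ?thesis by blast
    qed
    moreover have "\<exists>q\<in>send (\<sigma> n). sum_dist p q \<le> e" if n: "n \<ge> N" and p: "p \<in> S" for n p
    proof -
      obtain m q where m: "m \<ge> N" "q \<in> send (\<sigma> m)" "sum_dist p q < e / 2"
        using S_near[OF p, of "e / 2" N] e by auto
      obtain q' where "q' \<in> send (\<sigma> n)" "sum_dist q q' < e / 2"
        using H_send_lessD[OF F F N[OF m(1) n] m(2)] by blast
      then show ?thesis
        using m(3) sum_dist_triangle[of p q' q] by (intro bexI[of _ q']) auto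
    qed
    ultimately show ?thesis by blast
  qed
  have "\<exists>u. u \<in> F1_USCB \<and> send u = S"
  proof (rule sendograph_realization[OF \<open>compact S\<close>])
    show "0 \<le> t \<and> t \<le> 1" if "(x, t) \<in> S" for x t
      using that S_cyl by auto
    show "(x, s) \<in> S" if xt: "(x, t) \<in> S" and s: "0 \<le> s" "s \<le> t" for x s t
    proof (rule S_I)
      fix e :: real and N :: nat assume "0 < e"
      then obtain n y r where n: "n \<ge> N" "(y, r) \<in> send (\<sigma> n)" "sum_dist (x, t) (y, r) < e"
        using S_near[OF xt] by (metis surj_pair)
      \<comment> \<open>Truncating the height at \<open>s\<close> costs nothing: \<open>\<bar>s - min r s\<bar> \<le> \<bar>t - r\<bar>\<close> because \<open>s \<le> t\<close>.\<close>
      then have "(y, min r s) \<in> send (\<sigma> n)"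
        using s by (auto simp: mem_send_iff[OF F])
      moreover have "sum_dist (x, s) (y, min r s) < e"
        using n(3) s by (auto simp: sum_dist_def)
      ultimately show "\<exists>n\<ge>N. \<exists>q\<in>send (\<sigma> n). sum_dist (x, s) q < e"
        using n(1) by blast
    qed
    show "\<exists>x. (x, 1) \<in> S"
    proof -
      have "\<exists>p. p \<in> send (\<sigma> n) \<and> snd p = 1" for n
      proof -
        have "alpha_cut (\<sigma> n) 1 \<noteq> {}"
          using F[of n] by (auto simp: F1_USCB_def F1_USC_def)
        then obtain x where "x \<in> alpha_cut (\<sigma> n) 1" by blast
        then have "(x, 1) \<in> send (\<sigma> n)"
          using alpha_cut_subset_0[of 1 "\<sigma> n"] by (auto simp: mem_send_iff[OF F] alpha_cut_def)
        then show ?thesis by force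
      qed
      then obtain f where f: "\<And>n. f n \<in> send (\<sigma> n)" "\<And>n. snd (f n) = 1" by metis
      obtain q r where q: "q \<in> S" "(\<lambda>n. f (r n)) \<longlonglongrightarrow> q"
        using cluster[of 0 f] f(1) by blast
      have "snd q = 1"
        using tendsto_snd[OF q(2)] by (simp add: f(2) LIMSEQ_const_iff)
      with q(1) show ?thesis by (metis prod.collapse)
    qed
    show "\<exists>y t. (y, t) \<in> S \<and> 0 < t \<and> dist y x < \<epsilon>" if x: "(x, 0) \<in> S" and e: "0 < \<epsilon>" for x \<epsilon>
    proof -
      obtain \<delta> where \<delta>: "\<delta> \<in> {0<..1}"
        "\<And>u x. u \<in> U \<Longrightarrow> x \<in> alpha_cut u 0 \<Longrightarrow> \<exists>y\<in>alpha_cut u \<delta>. dist x y < \<epsilon> / 3"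
        using equi e unfolding equi_right_continuous_at_0_iff by (metis divide_pos_pos zero_less_numeral)
      \<comment> \<open>Within \<open>\<delta> / 2\<close> of height \<open>\<delta>\<close> every height is positive.\<close>
      define e where "e = min (\<epsilon> / 3) (\<delta> / 2)"
      have "0 < e" using \<open>0 < \<epsilon>\<close> \<delta>(1) by (simp add: e_def)
      then obtain N where N: "\<And>n p. n \<ge> N \<Longrightarrow> p \<in> send (\<sigma> n) \<Longrightarrow> \<exists>q\<in>S. sum_dist p q \<le> e"
        using conv by blast
      obtain n y r where n: "n \<ge> N" and y: "(y, r) \<in> send (\<sigma> n)" "sum_dist (x, 0) (y, r) < \<epsilon> / 3"
        using S_near[OF x, of "\<epsilon> / 3" N] \<open>0 < \<epsilon>\<close> by auto
      have "y \<in> alpha_cut (\<sigma> n) 0"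
        using y(1) by (simp add: mem_send_iff[OF F])
      then obtain z where z: "z \<in> alpha_cut (\<sigma> n) \<delta>" "dist y z < \<epsilon> / 3"
        using \<delta>(2)[OF \<sigma>] by blast
      then have "(z, \<delta>) \<in> send (\<sigma> n)"
        using \<delta>(1) alpha_cut_subset_0[of \<delta> "\<sigma> n"] by (auto simp: mem_send_iff[OF F] alpha_cut_def)
      then obtain w t where w: "(w, t) \<in> S" "sum_dist (z, \<delta>) (w, t) \<le> e"
        using N[OF n] by (metis surj_pair)
      then have "dist z w + \<bar>\<delta> - t\<bar> \<le> \<epsilon> / 3" "dist z w + \<bar>\<delta> - t\<bar> \<le> \<delta> / 2"
        by (simp_all add: sum_dist_def e_def)
      moreover have "0 < \<delta>" using \<delta>(1) by simp
      ultimately have "dist z w \<le> \<epsilon> / 3" "0 < t"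
        using zero_le_dist[of z w] by linarith+
      moreover have "dist x y < \<epsilon> / 3"
        using y(2) by (simp add: sum_dist_def)
      ultimately have "dist w x < \<epsilon>"
        using z(2) dist_triangle[of x w y] dist_triangle[of y w z] dist_commute[of w x] by linarith
      with w(1) \<open>0 < t\<close> show ?thesis by blast
    qed
  qed blast
  then obtain u where u: "u \<in> F1_USCB" "send u = S" by blast
  have "limitin send_topology \<sigma> u sequentially"
    unfolding limitin_send_topology
  proof (intro conjI allI impI u(1))
    fix \<epsilon> :: real assume e: "0 < \<epsilon>"
    then obtain N where N: "\<And>n. n \<ge> N \<Longrightarrow> (\<forall>p\<in>send (\<sigma> n). \<exists>q\<in>S. sum_dist p q \<le> \<epsilon> / 2) \<and>
      (\<forall>p\<in>S. \<exists>q\<in>send (\<sigma> n). sum_dist p q \<le> \<epsilon> / 2)"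
      using conv[of "\<epsilon> / 2"] by auto
    have "H_send (\<sigma> n) u < \<epsilon>" if "n \<ge> N" for n
    proof -
      have "H_send (\<sigma> n) u \<le> \<epsilon> / 2"
        using N[OF that] e by (intro H_send_leI) (auto simp: u(2))
      then show ?thesis using e by linarith
    qed
    then show "\<exists>N. \<forall>n\<ge>N. \<sigma> n \<in> F1_USCB \<and> H_send (\<sigma> n) u < \<epsilon>"
      using F by blast
  qed
  then show thesis by (rule that)
qed

section \<open>The characterization\<close>

lemma compactin_if_equi_right_continuous:
  fixes U :: "'a::metric_space fuzzy set"
  assumes UF: "U \<subseteq> F1_USCB" and cl: "closedin send_topology U"
    and rc: "relatively_compact (support_union U)" and equi: "equi_right_continuous_at_0 U"
  shows "compactin send_topology U"
proof -
  interpret Metric_space "F1_USCB :: 'a fuzzy set" H_send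
    by (rule Metric_space_H_send)
  let ?K = "closure (support_union U)"
  have K: "compact ?K" "support_union U \<subseteq> ?K"
    using rc closure_subset by (auto simp: relatively_compact_def)
  have "\<exists>u r. u \<in> U \<and> strict_mono r \<and> limitin send_topology (\<sigma> \<circ> r) u sequentially"
    if \<sigma>: "range \<sigma> \<subseteq> U" for \<sigma> :: "nat \<Rightarrow> 'a fuzzy"
  proof -
    obtain r where r: "strict_mono r" "MCauchy (\<sigma> \<circ> r)"
      using mtotally_bounded_sendographs[OF UF K] \<sigma> unfolding mtotally_bounded_sequentially by blast
    have U: "(\<sigma> \<circ> r) n \<in> U" for n
      using \<sigma> by auto
    have "\<exists>N. \<forall>m\<ge>N. \<forall>n\<ge>N. H_send ((\<sigma> \<circ> r) m) ((\<sigma> \<circ> r) n) < e" if "0 < e" for e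
      using r(2) that unfolding MCauchy_def by meson
    then obtain u where lim: "limitin send_topology (\<sigma> \<circ> r) u sequentially"
      using Cauchy_sendographs_converge[where \<sigma> = "\<sigma> \<circ> r", OF UF K equi U] by blast
    have "u \<in> U"
      by (rule limitin_closedin[OF lim cl]) (use U in auto)
    with r(1) lim show ?thesis by blast
  qed
  then show ?thesis
    using UF by (simp add: compactin_send_topology_sequentially)
qed

theorem theorem7p19:
  fixes U :: "'a::metric_space fuzzy set"
  assumes "U \<subseteq> F1_USCB"
  shows "(compactin send_topology U \<longleftrightarrow>
            closedin send_topology U \<and> relatively_compact (support_union U) \<and>
            equi_right_continuous_at_0 U)
       \<and> (compactin send_topology U \<longleftrightarrow>
            closedin send_topology U \<and> compact (support_union U) \<and>
            equi_right_continuous_at_0 U)"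
proof -
  interpret Metric_space "F1_USCB :: 'a fuzzy set" H_send
    by (rule Metric_space_H_send)
  have "compactin send_topology U \<Longrightarrow> closedin send_topology U"
    unfolding send_topology_def by (rule compactin_imp_closedin[OF Hausdorff_space_mtopology])
  moreover have "compact (support_union U) \<Longrightarrow> relatively_compact (support_union U)"
    by (simp add: relatively_compact_def compact_imp_closed)
  ultimately show ?thesis
    using compact_support_union compact_imp_equi_right_continuous
      compactin_if_equi_right_continuous[OF assms] by blast
qed

end
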